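(* Let $G$ be a banana tree, and let $k$ be the largest positive integer such that there exists a set $W$ of at least $k$ vertices of $G$ inducing a connected subgraph in which every pair of adjacent vertices is joined by at least $k$ edges. Then $\mathrm{sn}(G)=\mathrm{scw}(G)=k$.
   Context: Graphs are finite, connected, loopless multigraphs. A banana tree is a multigraph whose underlying simple graph (one edge kept between each adjacent pair) is a tree. For $S\subseteq V(G)$, $G[S]$ is the induced subgraph. A scramble on $G$ is a finite collection $\mathcal{S}=\{V_1,\ldots,V_m\}$ of nonempty vertex sets (eggs) with each $G[V_i]$ connected. The hitting number $h(\mathcal{S})$ is the minimum size of a vertex set meeting every egg. An egg-cut is a set $T$ of edges such that $(V(G),E(G)\setminus T)$ has at least two connected components each of which completely contains some egg; the egg-cut number $e(\mathcal{S})$ is the minimum size of an egg-cut (taken to be $\infty$ if none exists). The order of $\mathcal{S}$ is $\min\{h(\mathcal{S}),e(\mathcal{S})\}$, and the scramble number $\mathrm{sn}(G)$ is the maximum order of a scramble on $G$. A tree-cut decomposition of $G$ is a pair $(T,\mathcal{X})$ where $T$ is a tree (whose vertices are called nodes and edges links) and $\mathcal{X}:V(G)\to V(T)$ is any function. Each edge $uv$ of $G$ is routed along the unique path in $T$ from $\mathcal{X}(u)$ to $\mathcal{X}(v)$. The weight of a link is the number of edges of $G$ whose path uses that link; the weight of a node $t$ is $|\mathcal{X}^{-1}(t)|$ plus the number of edges of $G$ whose path passes through $t$ but neither of whose endpoints is mapped to $t$. The width of the decomposition is the maximum weight of a node or link, and the screewidth $\mathrm{scw}(G)$ is the minimum width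 of a tree-cut decomposition of $G$. *)

theory Defs
  imports Main "HOL-Library.Extended_Nat"
begin

text \<open>Undirected multigraphs: edges are abstract names, so parallel edges are distinct
  elements with the same set of ends.\<close>

record ('v, 'e) mgraph =
  verts :: "'v set"
  edges :: "'e set"
  ends :: "'e \<Rightarrow> 'v set"

definition edges_between :: "('v, 'e) mgraph \<Rightarrow> 'v \<Rightarrow> 'v \<Rightarrow> 'e set" where
  "edges_between G u v = {e \<in> edges G. ends G e = {u, v}}"

definition adjacent :: "('v, 'e) mgraph \<Rightarrow> 'v \<Rightarrow> 'v \<Rightarrow> bool" where
  "adjacent G u v \<longleftrightarrow> (\<exists>e \<in> edges G. ends G e = {u, v})"

definition connected_graph :: "('v, 'e) mgraph \<Rightarrow> bool" where
  "connected_graph G \<longleftrightarrow>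
     verts G \<noteq> {} \<and> (\<forall>u \<in> verts G. \<forall>v \<in> verts G. (adjacent G)\<^sup>*\<^sup>* u v)"

definition components :: "('v, 'e) mgraph \<Rightarrow> 'v set set" where
  "components G = (\<lambda>u. {v. (adjacent G)\<^sup>*\<^sup>* u v}) ` verts G"

definition multigraph :: "('v, 'e) mgraph \<Rightarrow> bool" where
  "multigraph G \<longleftrightarrow> finite (verts G) \<and> finite (edges G) \<and>
     (\<forall>e \<in> edges G. ends G e \<subseteq> verts G \<and> card (ends G e) = 2) \<and> connected_graph G"

definition induced :: "('v, 'e) mgraph \<Rightarrow> 'v set \<Rightarrow> ('v, 'e) mgraph" where
  "induced G S = \<lparr>verts = S, edges = {e \<in> edges G. ends G e \<subseteq> S}, ends = ends G\<rparr>"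

definition delete_edges :: "('v, 'e) mgraph \<Rightarrow> 'e set \<Rightarrow> ('v, 'e) mgraph" where
  "delete_edges G D = \<lparr>verts = verts G, edges = edges G - D, ends = ends G\<rparr>"

definition underlying_simple :: "('v, 'e) mgraph \<Rightarrow> ('v, 'v set) mgraph" where
  "underlying_simple G = \<lparr>verts = verts G, edges = ends G ` edges G, ends = (\<lambda>l. l)\<rparr>"

definition cycle :: "('v, 'e) mgraph \<Rightarrow> 'v list \<Rightarrow> bool" where
  "cycle G c \<longleftrightarrow> 3 \<le> length c \<and> distinct c \<and> successively (adjacent G) c \<and>
     adjacent G (last c) (hd c)"

text \<open>Cycles are given by vertex lists of length at least 3; cycles of length 2 (parallel
  edges) are excluded by injectivity of the ends.\<close>

definition tree :: "('v, 'e) mgraph \<Rightarrow> bool" where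
  "tree T \<longleftrightarrow> multigraph T \<and> inj_on (ends T) (edges T) \<and> (\<nexists>c. cycle T c)"

definition banana_tree :: "('v, 'e) mgraph \<Rightarrow> bool" where
  "banana_tree G \<longleftrightarrow> multigraph G \<and> tree (underlying_simple G)"

definition scramble :: "('v, 'e) mgraph \<Rightarrow> 'v set set \<Rightarrow> bool" where
  "scramble G \<S> \<longleftrightarrow> finite \<S> \<and>
     (\<forall>A \<in> \<S>. A \<noteq> {} \<and> A \<subseteq> verts G \<and> connected_graph (induced G A))"

definition hitting_number :: "('v, 'e) mgraph \<Rightarrow> 'v set set \<Rightarrow> nat" where
  "hitting_number G \<S> = Min (card ` {C. C \<subseteq> verts G \<and> (\<forall>A \<in> \<S>. C \<inter> A \<noteq> {})})"

definition egg_cut :: "('v, 'e) mgraph \<Rightarrow> 'v set set \<Rightarrow> 'e set \<Rightarrow> bool" where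
  "egg_cut G \<S> D \<longleftrightarrow> D \<subseteq> edges G \<and>
     (\<exists>C1 \<in> components (delete_edges G D). \<exists>C2 \<in> components (delete_edges G D).
        C1 \<noteq> C2 \<and> (\<exists>A \<in> \<S>. A \<subseteq> C1) \<and> (\<exists>A \<in> \<S>. A \<subseteq> C2))"

text \<open>The infimum of the empty set in \<^typ>\<open>enat\<close> is infinity.\<close>

definition egg_cut_number :: "('v, 'e) mgraph \<Rightarrow> 'v set set \<Rightarrow> enat" where
  "egg_cut_number G \<S> = Inf {enat (card D) | D. egg_cut G \<S> D}"

definition scramble_order :: "('v, 'e) mgraph \<Rightarrow> 'v set set \<Rightarrow> enat" where
  "scramble_order G \<S> = min (enat (hitting_number G \<S>)) (egg_cut_number G \<S>)"

definition scramble_number :: "('v, 'e) mgraph \<Rightarrow> enat" where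
  "scramble_number G = Max (scramble_order G ` {\<S>. scramble G \<S>})"

definition path :: "('n, 'l) mgraph \<Rightarrow> 'n \<Rightarrow> 'n list \<Rightarrow> 'n \<Rightarrow> bool" where
  "path T a p b \<longleftrightarrow> p \<noteq> [] \<and> hd p = a \<and> last p = b \<and> set p \<subseteq> verts T \<and> distinct p \<and>
     successively (adjacent T) p"

definition tree_cut_decomposition ::
  "('v, 'e) mgraph \<Rightarrow> ('n, 'l) mgraph \<Rightarrow> ('v \<Rightarrow> 'n) \<Rightarrow> bool" where
  "tree_cut_decomposition G T X \<longleftrightarrow> tree T \<and> X ` verts G \<subseteq> verts T"

text \<open>In a tree the path between two nodes is unique, so it may be bound existentially.
  Reversing it, i.e. exchanging the ends of the edge, does not change which nodes and links
  lie on it.\<close>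

definition routed_along ::
  "('v, 'e) mgraph \<Rightarrow> ('n, 'l) mgraph \<Rightarrow> ('v \<Rightarrow> 'n) \<Rightarrow> 'e \<Rightarrow> 'n list \<Rightarrow> bool" where
  "routed_along G T X e p \<longleftrightarrow> (\<exists>u v. ends G e = {u, v} \<and> path T (X u) p (X v))"

definition path_links :: "('n, 'l) mgraph \<Rightarrow> 'n list \<Rightarrow> 'l set" where
  "path_links T p = (\<Union>i \<in> {i. Suc i < length p}. edges_between T (p ! i) (p ! Suc i))"

definition link_weight ::
  "('v, 'e) mgraph \<Rightarrow> ('n, 'l) mgraph \<Rightarrow> ('v \<Rightarrow> 'n) \<Rightarrow> 'l \<Rightarrow> nat" where
  "link_weight G T X l =
     card {e \<in> edges G. \<exists>p. routed_along G T X e p \<and> l \<in> path_links T p}"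

definition node_weight ::
  "('v, 'e) mgraph \<Rightarrow> ('n, 'l) mgraph \<Rightarrow> ('v \<Rightarrow> 'n) \<Rightarrow> 'n \<Rightarrow> nat" where
  "node_weight G T X t = card {v \<in> verts G. X v = t} +
     card {e \<in> edges G. (\<exists>p. routed_along G T X e p \<and> t \<in> set p) \<and> t \<notin> X ` ends G e}"

definition width :: "('v, 'e) mgraph \<Rightarrow> ('n, 'l) mgraph \<Rightarrow> ('v \<Rightarrow> 'n) \<Rightarrow> nat" where
  "width G T X = Max (node_weight G T X ` verts T \<union> link_weight G T X ` edges T)"

text \<open>Every finite tree is isomorphic to one whose nodes and links are natural numbers.\<close>

definition screewidth :: "('v, 'e) mgraph \<Rightarrow> nat" where
  "screewidth G = (LEAST w. \<exists>(T :: (nat, nat) mgraph) X.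
     tree_cut_decomposition G T X \<and> width G T X = w)"

definition has_banana_core :: "('v, 'e) mgraph \<Rightarrow> nat \<Rightarrow> bool" where
  "has_banana_core G k \<longleftrightarrow> (\<exists>W \<subseteq> verts G. k \<le> card W \<and> connected_graph (induced G W) \<and>
     (\<forall>u v. adjacent (induced G W) u v \<longrightarrow> k \<le> card (edges_between (induced G W) u v)))"

end

theory Submission
  imports Defs
begin

text \<open>
  The eggs of the lower bound are the single vertices of a banana core: deleting fewer than
  \<open>k\<close> edges leaves an edge in every bundle, so it does not disconnect the core.

  For \<open>sn \<le> scw\<close>, which holds in every multigraph, suppose that the order of a scramble exceeds
  the width of a tree-cut decomposition over \<open>T\<close>. Then every node \<open>t\<close> is avoided by the routing
  of some egg, which therefore lies in a single component of \<open>T - t\<close>. Walking from each node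
  towards such an egg, one turns back over some link, and the edges routed over this link
  form an egg-cut that is too small.

  For \<open>scw \<le> k\<close>, contract all bundles of more than \<open>k\<close> edges. The result is a tree. A node weighs
  as much as its fibre has vertices, which is at most \<open>k\<close> because a larger fibre would be a banana
  core; a link weighs as much as the single bundle that it represents.
\<close>

section \<open>Adjacency and reachability\<close>

lemma verts_induced [simp]: "verts (induced G S) = S"
  and edges_induced [simp]: "edges (induced G S) = {e \<in> edges G. ends G e \<subseteq> S}"
  and ends_induced [simp]: "ends (induced G S) = ends G"
  by (simp_all add: induced_def)

lemma verts_delete_edges [simp]: "verts (delete_edges G D) = verts G"
  and edges_delete_edges [simp]: "edges (delete_edges G D) = edges G - D"
  and ends_delete_edges [simp]: "ends (delete_edges G D) = ends G"
  by (simp_all add: delete_edges_def)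

lemma adjacent_sym: "adjacent G u v \<Longrightarrow> adjacent G v u"
  by (simp add: adjacent_def insert_commute)

lemma adjacent_induced [simp]:
  "adjacent (induced G S) u v \<longleftrightarrow> adjacent G u v \<and> u \<in> S \<and> v \<in> S"
  by (auto simp: adjacent_def)

lemma edges_between_commute: "edges_between G u v = edges_between G v u"
  by (simp add: edges_between_def insert_commute)

lemma adjacent_iff_edges_between: "adjacent G u v \<longleftrightarrow> edges_between G u v \<noteq> {}"
  by (auto simp: adjacent_def edges_between_def)

lemma edges_between_induced:
  "u \<in> S \<Longrightarrow> v \<in> S \<Longrightarrow> edges_between (induced G S) u v = edges_between G u v"
  by (auto simp: edges_between_def)

lemma ends_eq_pair:
  assumes "multigraph G" "e \<in> edges G"
  obtains u v where "ends G e = {u, v}" "u \<in> verts G" "v \<in> verts G" "u \<noteq> v"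
proof -
  have "ends G e \<subseteq> verts G" "card (ends G e) = 2" using assms by (auto simp: multigraph_def)
  with that show thesis by (auto simp: card_2_iff)
qed

lemma adjacent_multigraphD:
  assumes "multigraph G" "adjacent G u v"
  shows "u \<in> verts G" "v \<in> verts G" "u \<noteq> v"
proof -
  obtain e where "e \<in> edges G" "ends G e = {u, v}"
    using assms(2) by (auto simp: adjacent_def)
  with ends_eq_pair[OF assms(1)] show "u \<in> verts G" "v \<in> verts G" "u \<noteq> v"
    by (metis doubleton_eq_iff)+
qed

abbreviation reachable :: "('v, 'e) mgraph \<Rightarrow> 'v \<Rightarrow> 'v \<Rightarrow> bool" where
  "reachable G \<equiv> (adjacent G)\<^sup>*\<^sup>*"

lemma reachable_sym: "reachable G u v \<Longrightarrow> reachable G v u"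
  by (rule sympD[OF symp_rtranclp]) (auto intro: sympI adjacent_sym)

lemma reachable_mono:
  assumes "reachable G u v" "\<And>x y. adjacent G x y \<Longrightarrow> adjacent H x y"
  shows "reachable H u v"
  using assms by (metis mono_rtranclp)

lemma reachable_image:
  assumes "reachable G u v" "\<And>x y. adjacent G x y \<Longrightarrow> reachable H (f x) (f y)"
  shows "reachable H (f u) (f v)"
  using assms(1) by induction (blast intro: rtranclp_trans assms(2))+

lemma reachable_in_verts:
  assumes "multigraph G" "u \<in> verts G" "reachable G u v"
  shows "v \<in> verts G"
  using assms(3,2) by induction (blast dest: adjacent_multigraphD(2)[OF assms(1)])+

lemma multigraph_reachable:
  "multigraph G \<Longrightarrow> u \<in> verts G \<Longrightarrow> v \<in> verts G \<Longrightarrow> reachable G u v"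
  by (simp add: multigraph_def connected_graph_def)

lemma connected_induced_reachable:
  "connected_graph (induced G S) \<Longrightarrow> u \<in> S \<Longrightarrow> v \<in> S \<Longrightarrow> reachable (induced G S) u v"
  by (simp add: connected_graph_def)

lemma induced_reachable_delete_edge:
  assumes "reachable (induced G S) u v" "\<not> ends G e \<subseteq> S"
  shows "reachable (delete_edges G {e}) u v"
  using assms(1) by (rule reachable_mono) (use assms(2) in \<open>auto simp: adjacent_def\<close>)

lemma connected_graph_mono:
  assumes "connected_graph G" "verts H = verts G" "\<And>x y. adjacent G x y \<Longrightarrow> adjacent H x y"
  shows "connected_graph H"
  using assms(1,2) reachable_mono[of G _ _ H, OF _ assms(3)] by (simp add: connected_graph_def)

lemma connected_induced_component: "connected_graph (induced G {v. reachable G u v})"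
proof -
  let ?C = "{v. reachable G u v}"
  have from_u: "reachable (induced G ?C) u v" if "reachable G u v" for v
    using that
  proof induction
    case (step v w)
    have "reachable G u w" using step.hyps by (rule rtranclp.rtrancl_into_rtrancl)
    with step.hyps have "adjacent (induced G ?C) v w" by simp
    with step.IH show ?case by (rule rtranclp.rtrancl_into_rtrancl)
  qed simp
  have "reachable (induced G ?C) v w" if "v \<in> ?C" "w \<in> ?C" for v w
    using rtranclp_trans[OF reachable_sym[OF from_u] from_u] that by simp
  then show ?thesis by (auto simp: connected_graph_def)
qed

lemma component_eq_iff: "{x. reachable G u x} = {x. reachable G v x} \<longleftrightarrow> reachable G u v"
proof
  assume "{x. reachable G u x} = {x. reachable G v x}"
  then show "reachable G u v" by blast
next
  assume reach: "reachable G u v"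
  have "reachable G u x \<longleftrightarrow> reachable G v x" for x
    using rtranclp_trans[OF reach] rtranclp_trans[OF reachable_sym[OF reach]] by blast
  then show "{x. reachable G u x} = {x. reachable G v x}" by simp
qed

section \<open>Walks, paths and cycles\<close>

lemma successively_imp_rtranclp:
  "successively R p \<Longrightarrow> p \<noteq> [] \<Longrightarrow> R\<^sup>*\<^sup>* (hd p) (last p)"
  by (induction p) (auto simp: successively_Cons intro: converse_rtranclp_into_rtranclp)

lemma rtranclp_imp_distinct_walk:
  assumes "R\<^sup>*\<^sup>* a b"
  shows "\<exists>p. p \<noteq> [] \<and> hd p = a \<and> last p = b \<and> distinct p \<and> successively R p"
  using assms
proof (induction rule: converse_rtranclp_induct)
  case base
  show ?case by (rule exI[of _ "[b]"]) simp
next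
  case (step a c)
  then obtain p where walk: "p \<noteq> []" "hd p = c" "last p = b" "distinct p" "successively R p"
    by blast
  show ?case
  proof (cases "a \<in> set p")
    case True
    then obtain xs ys where "p = xs @ a # ys" by (meson split_list)
    with walk show ?thesis
      by (intro exI[of _ "a # ys"]) (auto simp: successively_append_iff)
  next
    case False
    with walk step.hyps(1) show ?thesis
      by (intro exI[of _ "a # p"]) (auto simp: successively_Cons)
  qed
qed

lemma walk_in_verts:
  assumes "multigraph G" "successively (adjacent G) p" "p \<noteq> []" "hd p \<in> verts G"
  shows "set p \<subseteq> verts G"
  using assms(2-4)
proof (induction p)
  case (Cons x p)
  then show ?case
    using adjacent_multigraphD(2)[OF assms(1)] by (cases p) auto
qed simp

lemma path_exists:
  assumes "multigraph T" "a \<in> verts T" "b \<in> verts T"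
  obtains p where "path T a p b"
proof -
  obtain p where "p \<noteq> []" "hd p = a" "last p = b" "distinct p" "successively (adjacent T) p"
    using rtranclp_imp_distinct_walk[OF multigraph_reachable[OF assms]] by blast
  with assms that show thesis using walk_in_verts by (fastforce simp: path_def)
qed

lemma path_imp_reachable_induced:
  assumes "path T a p b" "set p \<subseteq> S"
  shows "reachable (induced T S) a b"
proof -
  have "successively (adjacent (induced T S)) p"
    by (rule successively_mono[of "adjacent T"]) (use assms in \<open>auto simp: path_def\<close>)
  with assms show ?thesis
    using successively_imp_rtranclp by (fastforce simp: path_def)
qed

lemma path_imp_reachable_delete_edges:
  assumes "path T a p b" "path_links T p \<inter> D = {}"
  shows "reachable (delete_edges T D) a b"
proof -
  have "adjacent (delete_edges T D) (p ! i) (p ! Suc i)" if consecutive: "Suc i < length p" for i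
  proof -
    have "adjacent T (p ! i) (p ! Suc i)"
      using assms(1) consecutive by (simp add: path_def successively_nth)
    then obtain l where "l \<in> edges_between T (p ! i) (p ! Suc i)"
      by (auto simp: adjacent_iff_edges_between)
    with assms(2) consecutive show ?thesis
      by (auto simp: adjacent_def path_links_def edges_between_def)
  qed
  then have "successively (adjacent (delete_edges T D)) p" by (simp add: successively_conv_nth)
  with assms(1) show ?thesis
    using successively_imp_rtranclp by (fastforce simp: path_def)
qed

lemma ends_subset_path_if_path_links:
  "l \<in> path_links T p \<Longrightarrow> ends T l \<subseteq> set p"
  by (auto simp: path_links_def edges_between_def)

lemma first_step_towards:
  assumes "multigraph T" "t \<in> verts T" "x \<in> verts T" "x \<noteq> t"
  obtains s where "adjacent T t s" "reachable (induced T (verts T - {t})) s x"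
proof -
  obtain p where path_to_x: "path T t p x" by (rule path_exists[OF assms(1-3)])
  with assms(4) obtain s q where split: "p = t # s # q"
    by (cases p; cases "tl p") (auto simp: path_def)
  have "path T s (s # q) x" "set (s # q) \<subseteq> verts T - {t}"
    using path_to_x unfolding split by (auto simp: path_def)
  then have "reachable (induced T (verts T - {t})) s x" by (rule path_imp_reachable_induced)
  with that path_to_x split show thesis by (auto simp: path_def)
qed

abbreviation acyclic_graph :: "('v, 'e) mgraph \<Rightarrow> bool" where
  "acyclic_graph G \<equiv> \<nexists>c. cycle G c"

abbreviation delete_bundle :: "('v, 'e) mgraph \<Rightarrow> 'v \<Rightarrow> 'v \<Rightarrow> ('v, 'e) mgraph" where
  "delete_bundle G u v \<equiv> delete_edges G (edges_between G u v)"

lemma adjacent_delete_bundle: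
  "adjacent (delete_bundle G u v) x y \<longleftrightarrow> adjacent G x y \<and> {x, y} \<noteq> {u, v}"
  by (auto simp: adjacent_def edges_between_def)

lemma acyclic_path_between_adjacent:
  assumes "acyclic_graph T" "adjacent T a b" "a \<noteq> b" "path T a p b"
  shows "p = [a, b]"
proof -
  have "\<not> 3 \<le> length p"
    using assms by (auto simp: path_def cycle_def intro: adjacent_sym)
  moreover obtain q where "p = a # q @ [b]"
    using assms(3,4) by (cases p; cases "tl p" rule: rev_cases) (auto simp: path_def)
  ultimately show ?thesis by (cases q) simp_all
qed

lemma path_refl_iff: "path T a p a \<longleftrightarrow> p = [a] \<and> a \<in> verts T"
  by (cases p) (auto simp: path_def split: if_splits)

lemma acyclic_imp_bundle_separates:
  assumes "multigraph G" "acyclic_graph G" "adjacent G u v"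
  shows "\<not> reachable (delete_bundle G u v) u v"
proof
  assume "reachable (delete_bundle G u v) u v"
  from rtranclp_imp_distinct_walk[OF this] obtain p
    where walk: "p \<noteq> []" "hd p = u" "last p = v" "distinct p"
      "successively (adjacent (delete_bundle G u v)) p"
    by blast
  have walk_in_G: "successively (adjacent G) p"
    using walk(5) by (rule successively_mono) (simp add: adjacent_delete_bundle)
  have "path G u p v"
    using walk walk_in_G walk_in_verts[OF assms(1) walk_in_G] adjacent_multigraphD(1)[OF assms(1,3)]
    by (simp add: path_def)
  with acyclic_path_between_adjacent[OF assms(2,3)] adjacent_multigraphD(3)[OF assms(1,3)]
  have "p = [u, v]" by blast
  with walk(5) show False by (simp add: adjacent_delete_bundle)
qed

lemma acyclic_if_bundles_separate:
  assumes "\<And>u v. adjacent G u v \<Longrightarrow> \<not> reachable (delete_bundle G u v) u v"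
  shows "acyclic_graph G"
proof
  assume "\<exists>c. cycle G c"
  then obtain c where circuit: "3 \<le> length c" "distinct c" "successively (adjacent G) c"
    and closing: "adjacent G (hd c) (last c)"
    by (auto simp: cycle_def intro: adjacent_sym)
  have nonempty: "c \<noteq> []" using circuit(1) by auto
  have "adjacent (delete_bundle G (hd c) (last c)) (c ! i) (c ! Suc i)"
    if consecutive: "Suc i < length c" for i
    unfolding adjacent_delete_bundle
  proof
    show "adjacent G (c ! i) (c ! Suc i)" using circuit(3) consecutive by (rule successively_nth)
    show "{c ! i, c ! Suc i} \<noteq> {hd c, last c}"
      using consecutive circuit(1,2) nonempty
      by (auto simp: hd_conv_nth last_conv_nth doubleton_eq_iff nth_eq_iff_index_eq)
  qed
  then have "reachable (delete_bundle G (hd c) (last c)) (hd c) (last c)"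
    using nonempty by (intro successively_imp_rtranclp) (simp_all add: successively_conv_nth)
  with assms[OF closing] show False by blast
qed

text \<open>Follow \<open>f\<close> along a longest duplicate-free walk; the image of its end closes a loop.\<close>

lemma finite_self_map_loop:
  assumes "finite S" "S \<noteq> {}" "\<And>x. x \<in> S \<Longrightarrow> f x \<in> S"
  obtains x xs where "distinct (x # xs)" "set (x # xs) \<subseteq> S" "successively (\<lambda>x y. y = f x) (x # xs)"
    "f (last (x # xs)) = x"
proof -
  define chain where "chain p \<longleftrightarrow> p \<noteq> [] \<and> distinct p \<and> set p \<subseteq> S \<and>
    successively (\<lambda>x y. y = f x) p" for p
  have "length p < Suc (card S)" if "chain p" for p
    using that assms(1) by (metis card_mono chain_def distinct_card le_imp_less_Suc)
  moreover obtain x where "x \<in> S" using assms(2) by blast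
  then have "chain [x]" by (simp add: chain_def)
  ultimately obtain p where chain: "chain p" and longest: "\<And>q. chain q \<Longrightarrow> length q \<le> length p"
    using Lattices_Big.ex_has_greatest_nat[of chain "[x]" length] by blast
  have "last p \<in> S" using chain by (auto simp: chain_def)
  have "f (last p) \<in> set p"
  proof (rule ccontr)
    assume "f (last p) \<notin> set p"
    then have "chain (p @ [f (last p)])"
      using chain assms(3)[OF \<open>last p \<in> S\<close>] by (auto simp: chain_def successively_append_iff)
    from longest[OF this] show False by simp
  qed
  then obtain y where y: "y \<in> set p" "f (last p) = y" by simp
  from split_list[OF y(1)] obtain ws xs where split: "p = ws @ y # xs" by blast
  show thesis
  proof (rule that)
    show "distinct (y # xs)" "set (y # xs) \<subseteq> S" "successively (\<lambda>x y. y = f x) (y # xs)"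
      using chain unfolding split chain_def by (simp_all add: successively_append_iff)
    show "f (last (y # xs)) = y" using y(2) split by simp
  qed
qed

lemma acyclic_walk_turns_back:
  assumes graph: "multigraph G" "acyclic_graph G"
    and step: "\<And>v. v \<in> verts G \<Longrightarrow> adjacent G v (f v)"
  obtains v where "v \<in> verts G" "f (f v) = v"
proof -
  have "finite (verts G)" "verts G \<noteq> {}"
    using graph(1) by (auto simp: multigraph_def connected_graph_def)
  moreover have "f v \<in> verts G" if "v \<in> verts G" for v
    using adjacent_multigraphD(2)[OF graph(1) step[OF that]] .
  ultimately obtain x xs where loop: "distinct (x # xs)" "set (x # xs) \<subseteq> verts G"
    "successively (\<lambda>x y. y = f x) (x # xs)" "f (last (x # xs)) = x"
    by (rule finite_self_map_loop)
  have "last (x # xs) \<in> verts G" using loop(2) last_in_set[of "x # xs"] by blast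
  from step[OF this] have closing: "adjacent G (last (x # xs)) x" unfolding loop(4) .
  show thesis
  proof (cases "length xs \<le> 1")
    case True
    with closing adjacent_multigraphD(3)[OF graph(1)] have "f (f x) = x"
      using loop(3,4) by (cases xs) fastforce+
    with loop(2) that[of x] show thesis by simp
  next
    case False
    have "successively (adjacent G) (x # xs)"
      using loop(3) by (rule successively_mono) (use loop(2) step in blast)
    with False loop(1) closing have "cycle G (x # xs)" by (simp add: cycle_def)
    with graph(2) show thesis by blast
  qed
qed

lemma treeD:
  assumes "tree T"
  shows "multigraph T" "acyclic_graph T"
  using assms by (simp_all add: tree_def)

lemma tree_link_separates:
  assumes "tree T" "l \<in> edges T" "ends T l = {t, s}"
  shows "\<not> reachable (delete_edges T {l}) t s"
proof -
  have "edges_between T t s = {l}"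
    using assms by (auto simp: tree_def edges_between_def inj_on_def)
  moreover have "adjacent T t s" using assms(2,3) by (auto simp: adjacent_def)
  ultimately show ?thesis using acyclic_imp_bundle_separates[OF treeD[OF assms(1)]] by metis
qed

lemma banana_treeD:
  assumes "banana_tree G"
  shows "multigraph G" "acyclic_graph G"
proof -
  have "adjacent (underlying_simple G) = adjacent G"
    by (auto simp: adjacent_def underlying_simple_def fun_eq_iff)
  with assms show "multigraph G" "acyclic_graph G"
    by (auto simp: banana_tree_def tree_def cycle_def)
qed

section \<open>Scrambles\<close>

lemma egg_cut_iff:
  "egg_cut G \<S> D \<longleftrightarrow> D \<subseteq> edges G \<and>
    (\<exists>u \<in> verts G. \<exists>v \<in> verts G. \<not> reachable (delete_edges G D) u v \<and>
      (\<exists>A \<in> \<S>. \<forall>a \<in> A. reachable (delete_edges G D) u a) \<and>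
      (\<exists>B \<in> \<S>. \<forall>b \<in> B. reachable (delete_edges G D) v b))"
proof -
  have "(\<exists>C1 \<in> components H. \<exists>C2 \<in> components H. C1 \<noteq> C2 \<and> (\<exists>A \<in> \<S>. A \<subseteq> C1) \<and> (\<exists>B \<in> \<S>. B \<subseteq> C2))
    \<longleftrightarrow> (\<exists>u \<in> verts H. \<exists>v \<in> verts H. \<not> reachable H u v \<and>
      (\<exists>A \<in> \<S>. \<forall>a \<in> A. reachable H u a) \<and> (\<exists>B \<in> \<S>. \<forall>b \<in> B. reachable H v b))"
    for H :: "('a, 'b) mgraph"
    unfolding components_def by (simp add: component_eq_iff subset_eq)
  from this[of "delete_edges G D"] show ?thesis unfolding egg_cut_def by simp
qed

lemma egg_cut_number_le: "egg_cut G \<S> D \<Longrightarrow> egg_cut_number G \<S> \<le> enat (card D)"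
  unfolding egg_cut_number_def by (rule Inf_lower) blast

lemma hitting_number_le:
  assumes "finite (verts G)" "C \<subseteq> verts G" "\<And>A. A \<in> \<S> \<Longrightarrow> C \<inter> A \<noteq> {}"
  shows "hitting_number G \<S> \<le> card C"
  unfolding hitting_number_def by (rule Min_le) (use assms in auto)

lemma finite_scrambles: "finite (verts G) \<Longrightarrow> finite {\<S>. scramble G \<S>}"
  by (rule finite_subset[of _ "Pow (Pow (verts G))"]) (auto simp: scramble_def)

lemma scramble_number_le_iff:
  assumes "finite (verts G)"
  shows "scramble_number G \<le> n \<longleftrightarrow> (\<forall>\<S>. scramble G \<S> \<longrightarrow> scramble_order G \<S> \<le> n)"
proof -
  have "scramble G {}" by (simp add: scramble_def)
  then show ?thesis
    unfolding scramble_number_def using finite_scrambles[OF assms] by (subst Max_le_iff) auto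
qed

lemma scramble_singletons:
  assumes "W \<subseteq> verts G" "finite W"
  shows "scramble G ((\<lambda>v. {v}) ` W)"
  using assms by (auto simp: scramble_def connected_graph_def)

lemma hitting_number_singletons:
  assumes "finite (verts G)" "W \<subseteq> verts G"
  shows "hitting_number G ((\<lambda>v. {v}) ` W) = card W"
proof (rule antisym)
  show "hitting_number G ((\<lambda>v. {v}) ` W) \<le> card W"
    using assms by (intro hitting_number_le) auto
  have "card W \<le> card C" if "C \<subseteq> verts G" "W \<subseteq> C" for C
    using that assms(1) by (meson card_mono finite_subset)
  then show "card W \<le> hitting_number G ((\<lambda>v. {v}) ` W)"
    unfolding hitting_number_def using assms by (subst Min_ge_iff) auto
qed

section \<open>Thick sets\<close>

definition thick :: "('v, 'e) mgraph \<Rightarrow> nat \<Rightarrow> 'v set \<Rightarrow> bool" where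
  "thick G k W \<longleftrightarrow> connected_graph (induced G W) \<and>
    (\<forall>u \<in> W. \<forall>v \<in> W. adjacent G u v \<longrightarrow> k \<le> card (edges_between G u v))"

lemma has_banana_core_iff:
  "has_banana_core G k \<longleftrightarrow> (\<exists>W \<subseteq> verts G. k \<le> card W \<and> thick G k W)"
  unfolding has_banana_core_def thick_def
  by (rule ex_cong1) (auto simp: edges_between_induced)

lemma has_banana_core_1:
  assumes "multigraph G"
  shows "has_banana_core G 1"
proof -
  obtain v where "v \<in> verts G"
    using assms by (auto simp: multigraph_def connected_graph_def)
  moreover have "thick G 1 {v}"
    using adjacent_multigraphD(3)[OF assms] by (auto simp: thick_def connected_graph_def)
  ultimately show ?thesis unfolding has_banana_core_iff by (intro exI[of _ "{v}"]) simp
qed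

lemma has_banana_core_le_card:
  assumes "finite (verts G)" "has_banana_core G k"
  shows "k \<le> card (verts G)"
  using assms by (meson card_mono has_banana_core_def order_trans)

lemma has_banana_core_Greatest:
  assumes "multigraph G" and greatest: "k = (GREATEST j. 0 < j \<and> has_banana_core G j)"
  shows "has_banana_core G k" "\<not> has_banana_core G (Suc k)"
proof -
  let ?P = "\<lambda>j. 0 < j \<and> has_banana_core G j"
  have bound: "j \<le> card (verts G)" if "?P j" for j
    using that assms(1) has_banana_core_le_card by (auto simp: multigraph_def)
  have "?P 1" using has_banana_core_1[OF assms(1)] by simp
  then have "?P k" unfolding greatest using bound by (rule GreatestI_nat)
  then show "has_banana_core G k" ..
  have "j \<le> k" if "?P j" for j unfolding greatest using that bound by (rule Greatest_le_nat)
  from this[of "Suc k"] show "\<not> has_banana_core G (Suc k)" by auto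
qed

lemma thick_reachable_delete_edges:
  assumes "thick G k W" "finite D" "card D < k" "u \<in> W" "v \<in> W"
  shows "reachable (delete_edges G D) u v"
proof (rule reachable_mono)
  show "reachable (induced G W) u v"
    using assms by (simp add: thick_def connected_induced_reachable)
  fix x y assume "adjacent (induced G W) x y"
  then have "card D < card (edges_between G x y)"
    using assms(1,3) by (force simp: thick_def)
  then have "\<not> edges_between G x y \<subseteq> D" using card_mono[OF assms(2)] by (metis not_le)
  then show "adjacent (delete_edges G D) x y" by (auto simp: adjacent_def edges_between_def)
qed

lemma egg_cut_singletons_thick:
  assumes "finite (edges G)" "thick G k W" "egg_cut G ((\<lambda>v. {v}) ` W) D"
  shows "k \<le> card D"
proof (rule ccontr)
  assume "\<not> k \<le> card D"
  moreover have "finite D" using assms(1,3) by (auto simp: egg_cut_def intro: finite_subset)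
  ultimately have still_connected: "reachable (delete_edges G D) a b" if "a \<in> W" "b \<in> W" for a b
    using that by (intro thick_reachable_delete_edges[OF assms(2)]) auto
  obtain u v a b where "a \<in> W" "b \<in> W" "\<not> reachable (delete_edges G D) u v"
    "reachable (delete_edges G D) u a" "reachable (delete_edges G D) v b"
    using assms(3) by (auto simp: egg_cut_iff)
  with still_connected show False by (meson reachable_sym rtranclp_trans)
qed

lemma has_banana_core_le_scramble_number:
  assumes multigraph: "multigraph G" and core: "has_banana_core G k"
  shows "enat k \<le> scramble_number G"
proof -
  obtain W where thick_W: "W \<subseteq> verts G" "k \<le> card W" "thick G k W"
    using core unfolding has_banana_core_iff by blast
  have finite: "finite (verts G)" "finite (edges G)" using multigraph by (auto simp: multigraph_def)
  let ?S = "(\<lambda>v. {v}) ` W"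
  have "enat k \<le> egg_cut_number G ?S"
    unfolding egg_cut_number_def
    by (rule Inf_greatest) (auto dest: egg_cut_singletons_thick[OF finite(2) thick_W(3)])
  then have "enat k \<le> scramble_order G ?S"
    using thick_W(2) hitting_number_singletons[OF finite(1) thick_W(1)]
    by (simp add: scramble_order_def)
  also have "\<dots> \<le> scramble_number G"
    using scramble_number_le_iff[OF finite(1)] scramble_singletons[OF thick_W(1)]
      thick_W(1) finite(1)
    by (meson finite_subset order_refl)
  finally show ?thesis .
qed

section \<open>Tree-cut decompositions\<close>

lemma width_le_iff:
  assumes "multigraph T"
  shows "width G T X \<le> w \<longleftrightarrow>
    (\<forall>t \<in> verts T. node_weight G T X t \<le> w) \<and> (\<forall>l \<in> edges T. link_weight G T X l \<le> w)"
proof -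
  have "finite (verts T)" "finite (edges T)" "verts T \<noteq> {}"
    using assms by (auto simp: multigraph_def connected_graph_def)
  then show ?thesis unfolding width_def by (subst Max_le_iff) auto
qed

locale tree_cut =
  fixes G :: "('v, 'e) mgraph" and T :: "('n, 'l) mgraph" and X :: "'v \<Rightarrow> 'n"
  assumes multigraph: "multigraph G" and decomposition: "tree_cut_decomposition G T X"
begin

lemma tree: "tree T"
  and multigraph_tree: "multigraph T"
  and X_in_verts: "v \<in> verts G \<Longrightarrow> X v \<in> verts T"
  using decomposition by (auto simp: tree_cut_decomposition_def tree_def)

lemma edge_routed:
  assumes "e \<in> edges G" "ends G e = {u, v}"
  obtains p where "path T (X u) p (X v)" "routed_along G T X e p"
proof -
  have "u \<in> verts G" "v \<in> verts G"
    using assms multigraph by (auto simp: multigraph_def)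
  then obtain p where "path T (X u) p (X v)"
    using path_exists[OF multigraph_tree] X_in_verts by metis
  with that assms(2) show thesis by (auto simp: routed_along_def)
qed

definition avoids :: "'v set \<Rightarrow> 'n \<Rightarrow> bool" where
  "avoids A t \<longleftrightarrow> t \<notin> X ` A \<and>
    (\<forall>e \<in> edges (induced G A). \<forall>p. routed_along G T X e p \<longrightarrow> t \<notin> set p)"

definition crossing_edges :: "'l \<Rightarrow> 'e set" where
  "crossing_edges l = {e \<in> edges G. \<exists>p. routed_along G T X e p \<and> l \<in> path_links T p}"

definition lies_beyond :: "'n \<Rightarrow> 'n \<Rightarrow> 'v set \<Rightarrow> bool" where
  "lies_beyond t s A \<longleftrightarrow> adjacent T t s \<and> avoids A t \<and>
    (\<forall>a \<in> A. reachable (induced T (verts T - {t})) s (X a))"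

text \<open>The vertices at \<open>t\<close> together with one end of each edge passing through \<open>t\<close> form a
  hitting set unless some egg avoids \<open>t\<close>.\<close>

lemma hitting_number_le_node_weight:
  assumes scramble: "scramble G \<S>" and not_avoided: "\<And>A. A \<in> \<S> \<Longrightarrow> \<not> avoids A t"
  shows "hitting_number G \<S> \<le> node_weight G T X t"
proof -
  define P where "P = {e \<in> edges G. (\<exists>p. routed_along G T X e p \<and> t \<in> set p) \<and> t \<notin> X ` ends G e}"
  have finite: "finite (verts G)" "finite P"
    using multigraph by (auto simp: multigraph_def P_def)
  have "\<exists>v. v \<in> ends G e" if "e \<in> edges G" for e
    using multigraph that by (rule ends_eq_pair) auto
  then obtain g where g_end: "\<And>e. e \<in> edges G \<Longrightarrow> g e \<in> ends G e" by metis
  let ?C = "{v \<in> verts G. X v = t} \<union> g ` P"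
  have "?C \<subseteq> verts G"
    using g_end multigraph by (fastforce simp: P_def multigraph_def)
  moreover have "?C \<inter> A \<noteq> {}" if egg: "A \<in> \<S>" for A
  proof (cases "t \<in> X ` A")
    case True
    with scramble egg show ?thesis by (auto simp: scramble_def)
  next
    case False
    with not_avoided[OF egg] obtain e p where through_t: "e \<in> edges G" "ends G e \<subseteq> A"
      "routed_along G T X e p" "t \<in> set p"
      by (auto simp: avoids_def)
    with False have "e \<in> P" by (auto simp: P_def)
    with through_t g_end show ?thesis by blast
  qed
  ultimately have "hitting_number G \<S> \<le> card ?C" by (rule hitting_number_le[OF finite(1)])
  also have "\<dots> \<le> card {v \<in> verts G. X v = t} + card (g ` P)" by (rule card_Un_le)
  also have "\<dots> \<le> node_weight G T X t"
    using card_image_le[OF finite(2)] by (simp add: node_weight_def P_def)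
  finally show ?thesis .
qed

lemma avoids_reachable:
  assumes egg: "connected_graph (induced G A)" "avoids A t" and vertices: "a \<in> A" "b \<in> A"
  shows "reachable (induced T (verts T - {t})) (X a) (X b)"
proof (rule reachable_image[where f = X])
  show "reachable (induced G A) a b" using egg(1) vertices by (rule connected_induced_reachable)
  fix x y assume "adjacent (induced G A) x y"
  then obtain e where edge: "e \<in> edges (induced G A)" "ends G e = {x, y}"
    by (auto simp: adjacent_def)
  from edge(1) have "e \<in> edges G" by simp
  then obtain p where route: "path T (X x) p (X y)" "routed_along G T X e p"
    using edge(2) by (rule edge_routed)
  then have "set p \<subseteq> verts T - {t}" using egg(2) edge(1) by (auto simp: avoids_def path_def)
  with route(1) show "reachable (induced T (verts T - {t})) (X x) (X y)"
    by (rule path_imp_reachable_induced)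
qed

lemma avoids_lies_beyond:
  assumes node: "t \<in> verts T"
    and egg: "A \<noteq> {}" "A \<subseteq> verts G" "connected_graph (induced G A)" "avoids A t"
  shows "\<exists>s. lies_beyond t s A"
proof -
  obtain a where vertex: "a \<in> A" using egg(1) by blast
  then have "X a \<in> verts T" "X a \<noteq> t" using egg(2,4) X_in_verts by (auto simp: avoids_def)
  then obtain s where first_step: "adjacent T t s" "reachable (induced T (verts T - {t})) s (X a)"
    by (rule first_step_towards[OF multigraph_tree node])
  have "reachable (induced T (verts T - {t})) s (X b)" if "b \<in> A" for b
    using first_step(2) avoids_reachable[OF egg(3,4) vertex that] by (rule rtranclp_trans)
  with first_step(1) egg(4) show ?thesis by (auto simp: lies_beyond_def)
qed

lemma uncrossed_reachable:
  assumes "reachable (delete_edges G (crossing_edges l)) u v"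
  shows "reachable (delete_edges T {l}) (X u) (X v)"
  using assms
proof (rule reachable_image[where f = X])
  fix x y assume "adjacent (delete_edges G (crossing_edges l)) x y"
  then obtain e where edge: "e \<in> edges G" "e \<notin> crossing_edges l" "ends G e = {x, y}"
    by (auto simp: adjacent_def)
  obtain p where route: "path T (X x) p (X y)" "routed_along G T X e p"
    using edge(1,3) by (rule edge_routed)
  with edge(1,2) have "path_links T p \<inter> {l} = {}" by (auto simp: crossing_edges_def)
  with route(1) show "reachable (delete_edges T {l}) (X x) (X y)"
    by (rule path_imp_reachable_delete_edges)
qed

lemma avoids_link_end_reachable:
  assumes "connected_graph (induced G A)" "avoids A t" "t \<in> ends T l" "a \<in> A" "b \<in> A"
  shows "reachable (delete_edges G (crossing_edges l)) a b"
proof (rule reachable_mono)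
  show "reachable (induced G A) a b" using assms(1,4,5) by (rule connected_induced_reachable)
  have "e \<notin> crossing_edges l" if "e \<in> edges (induced G A)" for e
    using that assms(2,3) ends_subset_path_if_path_links
    by (fastforce simp: avoids_def crossing_edges_def)
  then show "adjacent (delete_edges G (crossing_edges l)) x y"
    if "adjacent (induced G A) x y" for x y
    using that by (fastforce simp: adjacent_def)
qed

lemma egg_cut_crossing_edges:
  assumes scramble: "scramble G \<S>" "A \<in> \<S>" "B \<in> \<S>"
    and beyond: "lies_beyond t s A" "lies_beyond s t B"
    and link: "l \<in> edges T" "ends T l = {t, s}"
  shows "egg_cut G \<S> (crossing_edges l)"
proof -
  have conn: "connected_graph (induced G A)" "connected_graph (induced G B)"
    and "A \<noteq> {}" "A \<subseteq> verts G" "B \<noteq> {}" "B \<subseteq> verts G"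
    using scramble by (auto simp: scramble_def)
  then obtain a b where vertices: "a \<in> A" "b \<in> B" "a \<in> verts G" "b \<in> verts G" by blast
  have sides: "reachable (delete_edges T {l}) s (X a)" "reachable (delete_edges T {l}) t (X b)"
    using beyond vertices(1,2) link(2)
    by (auto simp: lies_beyond_def intro: induced_reachable_delete_edge)
  have "\<not> reachable (delete_edges G (crossing_edges l)) a b"
  proof
    assume "reachable (delete_edges G (crossing_edges l)) a b"
    then have "reachable (delete_edges T {l}) (X a) (X b)" by (rule uncrossed_reachable)
    with sides have "reachable (delete_edges T {l}) t s"
      by (meson reachable_sym rtranclp_trans)
    with tree_link_separates[OF tree link] show False by blast
  qed
  moreover have "\<forall>x \<in> A. reachable (delete_edges G (crossing_edges l)) a x"
    "\<forall>x \<in> B. reachable (delete_edges G (crossing_edges l)) b x"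
    using avoids_link_end_reachable conn beyond vertices(1,2) link(2)
    by (auto simp: lies_beyond_def)
  moreover have "crossing_edges l \<subseteq> edges G" by (auto simp: crossing_edges_def)
  ultimately show ?thesis using scramble(2,3) vertices(3,4) unfolding egg_cut_iff by blast
qed

lemma scramble_order_le_width:
  assumes scramble: "scramble G \<S>"
  shows "scramble_order G \<S> \<le> enat (width G T X)"
proof (cases "hitting_number G \<S> \<le> width G T X")
  case True
  then show ?thesis by (simp add: scramble_order_def min.coboundedI1)
next
  case False
  have weights: "\<And>t. t \<in> verts T \<Longrightarrow> node_weight G T X t \<le> width G T X"
    "\<And>l. l \<in> edges T \<Longrightarrow> link_weight G T X l \<le> width G T X"
    using width_le_iff[OF multigraph_tree, of G X "width G T X"] by simp_all
  have "\<exists>s A. A \<in> \<S> \<and> lies_beyond t s A" if node: "t \<in> verts T" for t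
  proof -
    have "\<not> hitting_number G \<S> \<le> node_weight G T X t"
      using weights(1)[OF node] False by simp
    then obtain A where "A \<in> \<S>" "avoids A t"
      using hitting_number_le_node_weight[OF scramble] by blast
    with avoids_lies_beyond[OF node, of A] scramble show ?thesis by (auto simp: scramble_def)
  qed
  then obtain f A where towards_egg: "\<And>t. t \<in> verts T \<Longrightarrow> A t \<in> \<S> \<and> lies_beyond t (f t) (A t)"
    by metis
  then obtain t where node: "t \<in> verts T" "f (f t) = t"
    using acyclic_walk_turns_back[OF treeD[OF tree], of f] by (auto simp: lies_beyond_def)
  have adj: "adjacent T t (f t)" using towards_egg[OF node(1)] by (simp add: lies_beyond_def)
  then obtain l where link: "l \<in> edges T" "ends T l = {t, f t}" by (auto simp: adjacent_def)
  have "A (f t) \<in> \<S> \<and> lies_beyond (f t) t (A (f t))"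
    using towards_egg[OF adjacent_multigraphD(2)[OF multigraph_tree adj]] node(2) by simp
  with towards_egg[OF node(1)] have "egg_cut G \<S> (crossing_edges l)"
    using egg_cut_crossing_edges[OF scramble _ _ _ _ link] by blast
  then have "egg_cut_number G \<S> \<le> enat (card (crossing_edges l))" by (rule egg_cut_number_le)
  also have "card (crossing_edges l) = link_weight G T X l"
    by (simp add: crossing_edges_def link_weight_def)
  also have "enat (link_weight G T X l) \<le> enat (width G T X)" using weights(2)[OF link(1)] by simp
  finally show ?thesis by (simp add: scramble_order_def min.coboundedI2)
qed

end

lemma width_attains_screewidth:
  "\<exists>(T :: (nat, nat) mgraph) X. tree_cut_decomposition G T X \<and> width G T X = screewidth G"
proof -
  let ?T = "\<lparr>verts = {0}, edges = {}, ends = \<lambda>_. {}\<rparr> :: (nat, nat) mgraph"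
  have "\<not> adjacent ?T u v" for u v by (simp add: adjacent_def)
  then have "tree ?T" by (simp add: tree_def multigraph_def connected_graph_def cycle_def)
  then have "tree_cut_decomposition G ?T (\<lambda>_. 0)" by (auto simp: tree_cut_decomposition_def)
  then have "\<exists>w (T :: (nat, nat) mgraph) X. tree_cut_decomposition G T X \<and> width G T X = w"
    by blast
  then show ?thesis unfolding screewidth_def by (rule LeastI_ex)
qed

lemma scramble_number_le_screewidth:
  assumes "multigraph G"
  shows "scramble_number G \<le> enat (screewidth G)"
proof -
  obtain T :: "(nat, nat) mgraph" and X where "tree_cut_decomposition G T X"
    and width_eq: "width G T X = screewidth G"
    using width_attains_screewidth by blast
  then interpret tree_cut G T X using assms by unfold_locales
  have "finite (verts G)" using assms by (simp add: multigraph_def)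
  then show ?thesis using scramble_order_le_width width_eq by (simp add: scramble_number_le_iff)
qed

section \<open>Relabelling the nodes and links of a tree\<close>

definition relabel :: "('n \<Rightarrow> 'm) \<Rightarrow> ('l \<Rightarrow> 'k) \<Rightarrow> ('n, 'l) mgraph \<Rightarrow> ('m, 'k) mgraph" where
  "relabel f g T = \<lparr>verts = f ` verts T, edges = g ` edges T,
    ends = (\<lambda>l. f ` ends T (inv_into (edges T) g l))\<rparr>"

locale relabelling =
  fixes T :: "('n, 'l) mgraph" and f :: "'n \<Rightarrow> 'm" and g :: "'l \<Rightarrow> 'k"
  assumes multigraph: "multigraph T"
    and inj_nodes: "inj_on f (verts T)" and inj_links: "inj_on g (edges T)"
begin

lemma verts_relabel [simp]: "verts (relabel f g T) = f ` verts T"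
  and edges_relabel [simp]: "edges (relabel f g T) = g ` edges T"
  and ends_relabel [simp]: "l \<in> edges T \<Longrightarrow> ends (relabel f g T) (g l) = f ` ends T l"
  using inj_links by (simp_all add: relabel_def)

lemma ends_in_verts: "l \<in> edges T \<Longrightarrow> ends T l \<subseteq> verts T"
  using multigraph by (simp add: multigraph_def)

lemma edges_between_relabel:
  assumes "a \<in> verts T" "b \<in> verts T"
  shows "edges_between (relabel f g T) (f a) (f b) = g ` edges_between T a b"
proof -
  have "f ` ends T l = {f a, f b} \<longleftrightarrow> ends T l = {a, b}" if "l \<in> edges T" for l
    using inj_on_image_eq_iff[OF inj_nodes ends_in_verts[OF that], of "{a, b}"] assms by simp
  then show ?thesis by (auto simp: edges_between_def)
qed

lemma adjacent_relabel:
  "a \<in> verts T \<Longrightarrow> b \<in> verts T \<Longrightarrow> adjacent (relabel f g T) (f a) (f b) \<longleftrightarrow> adjacent T a b"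
  by (simp add: adjacent_iff_edges_between edges_between_relabel)

lemma successively_adjacent_relabel:
  assumes "set p \<subseteq> verts T"
  shows "successively (adjacent (relabel f g T)) (map f p) \<longleftrightarrow> successively (adjacent T) p"
  unfolding successively_map
  by (rule successively_cong) (use assms adjacent_relabel in blast)+

lemma distinct_relabel: "set p \<subseteq> verts T \<Longrightarrow> distinct (map f p) \<longleftrightarrow> distinct p"
  by (simp add: distinct_map inj_on_subset[OF inj_nodes])

lemma relabelled_listE:
  assumes "set q \<subseteq> verts (relabel f g T)"
  obtains p where "q = map f p" "set p \<subseteq> verts T"
proof -
  have "q \<in> map f ` lists (verts T)" using assms by (auto simp flip: lists_image)
  with that show thesis by auto
qed

lemma multigraph_relabel: "multigraph (relabel f g T)"
  unfolding multigraph_def connected_graph_def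
proof (intro conjI ballI)
  show "finite (verts (relabel f g T))" "finite (edges (relabel f g T))"
    "verts (relabel f g T) \<noteq> {}"
    using multigraph by (auto simp: multigraph_def connected_graph_def)
next
  fix l' assume "l' \<in> edges (relabel f g T)"
  then obtain l where "l \<in> edges T" "l' = g l" by auto
  then show "ends (relabel f g T) l' \<subseteq> verts (relabel f g T)" "card (ends (relabel f g T) l') = 2"
    using multigraph ends_in_verts[of l] card_image[OF inj_on_subset[OF inj_nodes]]
    by (auto simp: multigraph_def)
next
  fix a' b' assume "a' \<in> verts (relabel f g T)" "b' \<in> verts (relabel f g T)"
  then obtain a b where preimages: "a \<in> verts T" "b \<in> verts T" "a' = f a" "b' = f b" by auto
  have "adjacent (relabel f g T) (f x) (f y)" if "adjacent T x y" for x y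
    using that adjacent_relabel adjacent_multigraphD(1,2)[OF multigraph] by blast
  then show "reachable (relabel f g T) a' b'"
    using reachable_image[OF multigraph_reachable[OF multigraph preimages(1,2)]] preimages(3,4)
    by blast
qed

lemma acyclic_relabel:
  assumes "acyclic_graph T"
  shows "acyclic_graph (relabel f g T)"
proof
  assume "\<exists>c. cycle (relabel f g T) c"
  then obtain c where circuit: "cycle (relabel f g T) c" by blast
  then have "set c \<subseteq> verts (relabel f g T)"
    using adjacent_multigraphD(2)[OF multigraph_relabel]
    by (intro walk_in_verts[OF multigraph_relabel]) (auto simp: cycle_def)
  then obtain p where preimage: "c = map f p" "set p \<subseteq> verts T" by (rule relabelled_listE)
  have nonempty: "p \<noteq> []" using circuit preimage(1) by (auto simp: cycle_def)
  with preimage(2) have "last p \<in> verts T" "hd p \<in> verts T" by auto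
  with circuit preimage nonempty have "cycle T p"
    by (simp add: cycle_def successively_adjacent_relabel distinct_relabel
        last_map hd_map adjacent_relabel)
  with assms show False by blast
qed

lemma tree_relabel:
  assumes "tree T"
  shows "tree (relabel f g T)"
proof -
  have "l = l'" if "l \<in> edges T" "l' \<in> edges T" "f ` ends T l = f ` ends T l'" for l l'
    using that assms inj_on_image_eq_iff[OF inj_nodes ends_in_verts ends_in_verts]
    by (simp add: tree_def inj_on_def)
  then have "inj_on (ends (relabel f g T)) (edges (relabel f g T))" by (auto simp: inj_on_def)
  with multigraph_relabel acyclic_relabel[OF treeD(2)[OF assms]] show ?thesis
    by (simp add: tree_def)
qed

lemma path_relabelD:
  assumes "path (relabel f g T) (f a) q (f b)" "a \<in> verts T" "b \<in> verts T"
  obtains p where "q = map f p" "path T a p b"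
proof -
  have "set q \<subseteq> verts (relabel f g T)" using assms(1) by (simp add: path_def)
  then obtain p where preimage: "q = map f p" "set p \<subseteq> verts T" by (rule relabelled_listE)
  have nonempty: "p \<noteq> []" using assms(1) preimage(1) by (auto simp: path_def)
  then have "hd p \<in> verts T" "last p \<in> verts T" using preimage(2) by auto
  with assms preimage nonempty have "path T a p b"
    by (auto simp: path_def hd_map last_map distinct_relabel successively_adjacent_relabel
        dest: inj_onD[OF inj_nodes])
  with that preimage(1) show thesis by blast
qed

lemma path_links_relabel:
  assumes "set p \<subseteq> verts T"
  shows "path_links (relabel f g T) (map f p) = g ` path_links T p"
proof -
  have "edges_between (relabel f g T) (map f p ! i) (map f p ! Suc i)
      = g ` edges_between T (p ! i) (p ! Suc i)" if "Suc i < length p" for i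
    using that assms by (simp add: edges_between_relabel subset_iff)
  then show ?thesis by (simp add: path_links_def image_UN)
qed

context
  fixes G :: "('v, 'e) mgraph" and X :: "'v \<Rightarrow> 'n"
  assumes multigraph_G: "multigraph G" and nodes: "X ` verts G \<subseteq> verts T"
begin

lemma routed_along_relabelD:
  assumes "e \<in> edges G" "routed_along G (relabel f g T) (f \<circ> X) e q"
  obtains p where "q = map f p" "set p \<subseteq> verts T" "routed_along G T X e p"
proof -
  obtain u v where route: "ends G e = {u, v}" "path (relabel f g T) (f (X u)) q (f (X v))"
    using assms(2) by (auto simp: routed_along_def)
  then have "X u \<in> verts T" "X v \<in> verts T"
    using assms(1) multigraph_G nodes by (fastforce simp: multigraph_def)+
  with route(2) obtain p where "q = map f p" "path T (X u) p (X v)" by (rule path_relabelD)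
  with that route(1) show thesis by (auto simp: routed_along_def path_def)
qed

lemma node_weight_relabel_le:
  assumes node: "t \<in> verts T"
  shows "node_weight G (relabel f g T) (f \<circ> X) (f t) \<le> node_weight G T X t"
  unfolding node_weight_def
proof (intro add_mono card_mono)
  show "{v \<in> verts G. (f \<circ> X) v = f t} \<subseteq> {v \<in> verts G. X v = t}"
    using nodes node inj_onD[OF inj_nodes] by auto
  show "{e \<in> edges G. (\<exists>q. routed_along G (relabel f g T) (f \<circ> X) e q \<and> f t \<in> set q) \<and>
      f t \<notin> (f \<circ> X) ` ends G e}
    \<subseteq> {e \<in> edges G. (\<exists>p. routed_along G T X e p \<and> t \<in> set p) \<and> t \<notin> X ` ends G e}"
  proof clarify
    fix e q assume through_t: "e \<in> edges G" "routed_along G (relabel f g T) (f \<circ> X) e q"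
      "f t \<in> set q" "f t \<notin> (f \<circ> X) ` ends G e"
    obtain p where preimage: "q = map f p" "set p \<subseteq> verts T" "routed_along G T X e p"
      using through_t(1,2) by (rule routed_along_relabelD)
    with through_t(3) have "t \<in> set p" using inj_on_image_mem_iff[OF inj_nodes node] by simp
    with preimage(3) through_t(4) show "(\<exists>p. routed_along G T X e p \<and> t \<in> set p) \<and> t \<notin> X ` ends G e"
      by auto
  qed
qed (use multigraph_G in \<open>simp_all add: multigraph_def\<close>)

lemma link_weight_relabel_le:
  assumes link: "l \<in> edges T"
  shows "link_weight G (relabel f g T) (f \<circ> X) (g l) \<le> link_weight G T X l"
  unfolding link_weight_def
proof (rule card_mono)
  show "{e \<in> edges G. \<exists>q. routed_along G (relabel f g T) (f \<circ> X) e q \<and>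
      g l \<in> path_links (relabel f g T) q}
    \<subseteq> {e \<in> edges G. \<exists>p. routed_along G T X e p \<and> l \<in> path_links T p}"
  proof clarify
    fix e q assume crossing: "e \<in> edges G" "routed_along G (relabel f g T) (f \<circ> X) e q"
      "g l \<in> path_links (relabel f g T) q"
    obtain p where preimage: "q = map f p" "set p \<subseteq> verts T" "routed_along G T X e p"
      using crossing(1,2) by (rule routed_along_relabelD)
    have "path_links T p \<subseteq> edges T" by (auto simp: path_links_def edges_between_def)
    with crossing(3) link preimage(1,2) have "l \<in> path_links T p"
      by (simp add: path_links_relabel inj_on_image_mem_iff[OF inj_links])
    with preimage(3) show "\<exists>p. routed_along G T X e p \<and> l \<in> path_links T p" by blast
  qed
qed (use multigraph_G in \<open>simp add: multigraph_def\<close>)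

lemma width_relabel_le: "width G (relabel f g T) (f \<circ> X) \<le> width G T X"
  using width_le_iff[OF multigraph, of G X "width G T X"]
  by (auto simp: width_le_iff[OF multigraph_relabel]
      intro: node_weight_relabel_le link_weight_relabel_le order_trans)

end

end

lemma screewidth_le_width:
  assumes multigraph_G: "multigraph G" and decomposition: "tree_cut_decomposition G T X"
  shows "screewidth G \<le> width G T X"
proof -
  have tree_T: "tree T" and nodes: "X ` verts G \<subseteq> verts T"
    using decomposition by (simp_all add: tree_cut_decomposition_def)
  then obtain f :: "'c \<Rightarrow> nat" and g :: "'d \<Rightarrow> nat"
    where "inj_on f (verts T)" "inj_on g (edges T)"
    by (metis finite_imp_inj_to_nat_seg multigraph_def tree_def)
  then interpret relabelling T f g using treeD(1)[OF tree_T] by unfold_locales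
  have "tree_cut_decomposition G (relabel f g T) (f \<circ> X)"
    using tree_relabel[OF tree_T] nodes by (auto simp: tree_cut_decomposition_def)
  then have "screewidth G \<le> width G (relabel f g T) (f \<circ> X)"
    unfolding screewidth_def by (intro Least_le) blast
  with width_relabel_le[OF multigraph_G nodes] show ?thesis by (rule order_trans[rotated])
qed

section \<open>Contractions\<close>

definition contraction :: "('v, 'e) mgraph \<Rightarrow> ('v \<Rightarrow> 'n) \<Rightarrow> ('n, 'n set) mgraph" where
  "contraction G X = \<lparr>verts = X ` verts G,
    edges = {{X u, X v} |u v. adjacent G u v \<and> X u \<noteq> X v}, ends = (\<lambda>l. l)\<rparr>"

lemma verts_contraction [simp]: "verts (contraction G X) = X ` verts G"
  and ends_contraction [simp]: "ends (contraction G X) = (\<lambda>l. l)"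
  by (simp_all add: contraction_def)

lemma edges_contraction:
  "edges (contraction G X) = {{X u, X v} |u v. adjacent G u v \<and> X u \<noteq> X v}"
  by (simp add: contraction_def)

lemma adjacent_contraction:
  "adjacent (contraction G X) a b \<longleftrightarrow> (\<exists>u v. adjacent G u v \<and> X u = a \<and> X v = b \<and> a \<noteq> b)"
  by (auto simp: adjacent_def[of "contraction G X"] edges_contraction doubleton_eq_iff)
    (blast dest: adjacent_sym)

locale acyclic_contraction =
  fixes G :: "('v, 'e) mgraph" and X :: "'v \<Rightarrow> 'n"
  assumes multigraph: "multigraph G" and acyclic: "acyclic_graph G"
    and fibres_connected: "u \<in> verts G \<Longrightarrow> v \<in> verts G \<Longrightarrow> X u = X v \<Longrightarrow>
      reachable (induced G {w \<in> verts G. X w = X u}) u v"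
begin

lemma fibre_reachable_delete_bundle:
  assumes "X u \<noteq> X v" "x \<in> verts G" "y \<in> verts G" "X x = X y"
  shows "reachable (delete_bundle G u v) x y"
  using fibres_connected[OF assms(2-4)]
  by (rule reachable_mono) (use assms(1) in \<open>auto simp: adjacent_delete_bundle doubleton_eq_iff\<close>)

lemma bundle_unique:
  assumes uv: "adjacent G u v" "X u \<noteq> X v" and xy: "adjacent G x y" "X x = X u" "X y = X v"
  shows "{x, y} = {u, v}"
proof (rule ccontr)
  assume "{x, y} \<noteq> {u, v}"
  with xy(1) have "adjacent (delete_bundle G u v) x y" by (simp add: adjacent_delete_bundle)
  moreover have "reachable (delete_bundle G u v) u x" "reachable (delete_bundle G u v) y v"
    using fibre_reachable_delete_bundle[OF uv(2)] xy(2,3)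
      adjacent_multigraphD(1,2)[OF multigraph uv(1)] adjacent_multigraphD(1,2)[OF multigraph xy(1)]
    by simp_all
  ultimately have "reachable (delete_bundle G u v) u v"
    by (meson rtranclp.rtrancl_into_rtrancl rtranclp_trans)
  with acyclic_imp_bundle_separates[OF multigraph acyclic uv(1)] show False by blast
qed

lemma reachable_lift_delete_bundle:
  assumes "X u \<noteq> X v" "u \<in> verts G"
    and "reachable (delete_bundle (contraction G X) (X u) (X v)) (X u) b"
  shows "\<forall>w \<in> verts G. X w = b \<longrightarrow> reachable (delete_bundle G u v) u w"
  using assms(3)
proof induction
  case base
  show ?case using fibre_reachable_delete_bundle[OF assms(1,2)] by simp
next
  case (step a b)
  then obtain x y where xy: "adjacent G x y" "X x = a" "X y = b"
    and other_link: "{a, b} \<noteq> {X u, X v}"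
    by (auto simp: adjacent_delete_bundle adjacent_contraction)
  note xy_verts = adjacent_multigraphD(1,2)[OF multigraph xy(1)]
  have "adjacent (delete_bundle G u v) x y"
    using xy other_link by (auto simp: adjacent_delete_bundle doubleton_eq_iff)
  with step.IH xy_verts(1) xy(2) have reach_y: "reachable (delete_bundle G u v) u y"
    by (blast intro: rtranclp.rtrancl_into_rtrancl)
  show ?case
  proof (intro ballI impI)
    fix w assume "w \<in> verts G" "X w = b"
    then have "reachable (delete_bundle G u v) y w"
      using fibre_reachable_delete_bundle[OF assms(1) xy_verts(2)] xy(3) by simp
    with reach_y show "reachable (delete_bundle G u v) u w" by (rule rtranclp_trans)
  qed
qed

lemma acyclic_contraction: "acyclic_graph (contraction G X)"
proof (rule acyclic_if_bundles_separate, rule notI)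
  fix a b assume "adjacent (contraction G X) a b"
  then obtain u v where uv: "adjacent G u v" "X u = a" "X v = b" "X u \<noteq> X v"
    by (auto simp: adjacent_contraction)
  note uv_verts = adjacent_multigraphD(1,2)[OF multigraph uv(1)]
  assume "reachable (delete_bundle (contraction G X) a b) a b"
  then have "reachable (delete_bundle G u v) u v"
    using reachable_lift_delete_bundle[OF uv(4) uv_verts(1)] uv(2,3) uv_verts(2) by blast
  with acyclic_imp_bundle_separates[OF multigraph acyclic uv(1)] show False by blast
qed

lemma multigraph_contraction: "multigraph (contraction G X)"
  unfolding multigraph_def connected_graph_def
proof (intro conjI ballI)
  have "edges (contraction G X) \<subseteq> Pow (X ` verts G)"
    by (auto simp: edges_contraction dest: adjacent_multigraphD[OF multigraph])
  then show "finite (verts (contraction G X))" "finite (edges (contraction G X))"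
    using multigraph by (auto simp: multigraph_def intro: finite_subset)
  show "verts (contraction G X) \<noteq> {}"
    using multigraph by (simp add: multigraph_def connected_graph_def)
next
  fix l assume "l \<in> edges (contraction G X)"
  then show "ends (contraction G X) l \<subseteq> verts (contraction G X)"
    "card (ends (contraction G X) l) = 2"
    by (auto simp: edges_contraction dest: adjacent_multigraphD[OF multigraph])
next
  fix a b assume "a \<in> verts (contraction G X)" "b \<in> verts (contraction G X)"
  then obtain u v where preimages: "u \<in> verts G" "v \<in> verts G" "a = X u" "b = X v" by auto
  have "reachable (contraction G X) (X x) (X y)" if "adjacent G x y" for x y
  proof (cases "X x = X y")
    case False
    with that have "adjacent (contraction G X) (X x) (X y)" by (auto simp: adjacent_contraction)
    then show ?thesis by blast
  qed simp
  then show "reachable (contraction G X) a b"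
    using reachable_image[OF multigraph_reachable[OF multigraph preimages(1,2)]] preimages(3,4)
    by blast
qed

lemma tree_contraction: "tree (contraction G X)"
  using multigraph_contraction acyclic_contraction by (simp add: tree_def)

lemma routed_along_contraction:
  assumes "e \<in> edges G"
  shows "routed_along G (contraction G X) X e p \<longleftrightarrow>
    (\<exists>u v. ends G e = {u, v} \<and> p = (if X u = X v then [X u] else [X u, X v]))"
proof -
  have "path (contraction G X) (X u) p (X v) \<longleftrightarrow> p = (if X u = X v then [X u] else [X u, X v])"
    if "ends G e = {u, v}" for u v
  proof (cases "X u = X v")
    case True
    have "v \<in> verts G" using assms that multigraph by (auto simp: multigraph_def)
    with True show ?thesis by (simp add: path_refl_iff)
  next
    case False
    have "adjacent G u v" using assms that by (auto simp: adjacent_def)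
    with False have adj: "adjacent (contraction G X) (X u) (X v)"
      by (auto simp: adjacent_contraction)
    have "path (contraction G X) (X u) [X u, X v] (X v)"
      using adj False adjacent_multigraphD(1,2)[OF multigraph_contraction adj]
      by (simp add: path_def)
    then have "path (contraction G X) (X u) p (X v) \<longleftrightarrow> p = [X u, X v]"
      using acyclic_path_between_adjacent[OF acyclic_contraction adj False] by blast
    with False show ?thesis by simp
  qed
  then show ?thesis unfolding routed_along_def by blast
qed

lemma node_weight_contraction:
  "node_weight G (contraction G X) X t = card {v \<in> verts G. X v = t}"
proof -
  have "{e \<in> edges G. (\<exists>p. routed_along G (contraction G X) X e p \<and> t \<in> set p) \<and>
      t \<notin> X ` ends G e} = {}"
    by (auto simp: routed_along_contraction split: if_splits)
  then show ?thesis unfolding node_weight_def by (simp only: card.empty add_0_right)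
qed

lemma link_weight_contraction:
  assumes uv: "adjacent G u v" "X u \<noteq> X v"
  shows "link_weight G (contraction G X) X {X u, X v} = card (edges_between G u v)"
proof -
  have crosses: "(\<exists>p. routed_along G (contraction G X) X e p \<and>
      {X u, X v} \<in> path_links (contraction G X) p) \<longleftrightarrow> ends G e = {u, v}"
    if edge: "e \<in> edges G" for e
  proof
    assume "\<exists>p. routed_along G (contraction G X) X e p \<and>
      {X u, X v} \<in> path_links (contraction G X) p"
    then obtain x y where xy: "ends G e = {x, y}" "{X u, X v} = {X x, X y}"
      using edge uv(2)
      by (auto simp: routed_along_contraction path_links_def edges_between_def split: if_splits)
    have "adjacent G x y" "adjacent G y x" using edge xy(1) by (auto simp: adjacent_def)
    with xy bundle_unique[OF uv] show "ends G e = {u, v}"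
      by (metis doubleton_eq_iff)
  next
    assume "ends G e = {u, v}"
    moreover have "{X u, X v} \<in> path_links (contraction G X) [X u, X v]"
      using uv by (auto simp: path_links_def edges_between_def edges_contraction)
    ultimately show "\<exists>p. routed_along G (contraction G X) X e p \<and>
      {X u, X v} \<in> path_links (contraction G X) p"
      using edge uv(2) routed_along_contraction by auto
  qed
  show ?thesis
    unfolding link_weight_def edges_between_def
    by (rule arg_cong[where f = card]) (use crosses in blast)
qed

lemma width_contraction_le_iff:
  "width G (contraction G X) X \<le> k \<longleftrightarrow>
    (\<forall>u \<in> verts G. card {v \<in> verts G. X v = X u} \<le> k) \<and>
    (\<forall>u v. adjacent G u v \<longrightarrow> X u \<noteq> X v \<longrightarrow> card (edges_between G u v) \<le> k)"
proof -
  have "(\<forall>l \<in> edges (contraction G X). link_weight G (contraction G X) X l \<le> k) \<longleftrightarrow>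
    (\<forall>u v. adjacent G u v \<longrightarrow> X u \<noteq> X v \<longrightarrow> card (edges_between G u v) \<le> k)"
    by (auto simp: edges_contraction) (metis link_weight_contraction)+
  then show ?thesis
    by (simp add: width_le_iff[OF multigraph_contraction] node_weight_contraction)
qed

end

section \<open>Contracting thick bundles\<close>

definition thick_subgraph :: "('v, 'e) mgraph \<Rightarrow> nat \<Rightarrow> ('v, 'e) mgraph" where
  "thick_subgraph G k = delete_edges G {e. card {e' \<in> edges G. ends G e' = ends G e} < k}"

lemma adjacent_thick_subgraph:
  "adjacent (thick_subgraph G k) u v \<longleftrightarrow> adjacent G u v \<and> k \<le> card (edges_between G u v)"
  by (auto simp: thick_subgraph_def adjacent_def edges_between_def not_less)

definition thick_component :: "('v, 'e) mgraph \<Rightarrow> nat \<Rightarrow> 'v \<Rightarrow> 'v set" where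
  "thick_component G k u = {v. reachable (thick_subgraph G k) u v}"

lemma thick_component_eq_iff:
  "thick_component G k u = thick_component G k v \<longleftrightarrow> reachable (thick_subgraph G k) u v"
  unfolding thick_component_def by (rule component_eq_iff)

lemma in_thick_component_iff:
  "v \<in> thick_component G k u \<longleftrightarrow> thick_component G k v = thick_component G k u"
  unfolding thick_component_eq_iff
  by (auto simp: thick_component_def intro: reachable_sym)

lemma thick_component_subset:
  assumes "multigraph G" "u \<in> verts G"
  shows "thick_component G k u \<subseteq> verts G"
proof
  fix v assume "v \<in> thick_component G k u"
  then have "reachable G u v"
    by (auto simp: thick_component_def adjacent_thick_subgraph elim: reachable_mono)
  with assms show "v \<in> verts G" by (rule reachable_in_verts)
qed

lemma fibre_thick_component:
  assumes "multigraph G" "u \<in> verts G"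
  shows "{v \<in> verts G. thick_component G k v = thick_component G k u} = thick_component G k u"
  using thick_component_subset[OF assms] by (auto simp: in_thick_component_iff)

lemma thick_component_connected: "connected_graph (induced G (thick_component G k u))"
proof -
  let ?C = "thick_component G k u"
  have "connected_graph (induced (thick_subgraph G k) ?C)"
    unfolding thick_component_def by (rule connected_induced_component)
  then show ?thesis by (rule connected_graph_mono) (simp_all add: adjacent_thick_subgraph)
qed

lemma thick_thick_component:
  assumes "multigraph G" "acyclic_graph G"
  shows "thick G k (thick_component G k u)"
  unfolding thick_def
proof (intro conjI ballI impI)
  show "connected_graph (induced G (thick_component G k u))" by (rule thick_component_connected)
  fix x y assume "x \<in> thick_component G k u" "y \<in> thick_component G k u"
  then have xy: "reachable (thick_subgraph G k) x y"
    by (simp add: in_thick_component_iff flip: thick_component_eq_iff)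
  assume adj: "adjacent G x y"
  show "k \<le> card (edges_between G x y)"
  proof (rule ccontr)
    assume "\<not> k \<le> card (edges_between G x y)"
    then have "reachable (delete_bundle G x y) x y"
      using xy by (elim reachable_mono)
        (auto simp: adjacent_thick_subgraph adjacent_delete_bundle doubleton_eq_iff
          edges_between_commute)
    with acyclic_imp_bundle_separates[OF assms adj] show False by blast
  qed
qed

lemma screewidth_le_if_no_banana_core:
  assumes graph: "multigraph G" "acyclic_graph G" and no_core: "\<not> has_banana_core G (Suc k)"
  shows "screewidth G \<le> k"
proof -
  let ?X = "thick_component G (Suc k)"
  interpret acyclic_contraction G ?X
  proof
    fix u v assume uv: "u \<in> verts G" "v \<in> verts G" "?X u = ?X v"
    then have "u \<in> ?X u" "v \<in> ?X u" by (simp_all add: in_thick_component_iff)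
    then show "reachable (induced G {w \<in> verts G. ?X w = ?X u}) u v"
      unfolding fibre_thick_component[OF graph(1) uv(1)]
      by (intro connected_induced_reachable thick_component_connected)
  qed (use graph in auto)
  have "card (?X u) \<le> k" if "u \<in> verts G" for u
    using no_core thick_thick_component[OF graph] thick_component_subset[OF graph(1) that]
    unfolding has_banana_core_iff by (meson not_less_eq_eq)
  moreover have "card (edges_between G u v) \<le> k" if "adjacent G u v" "?X u \<noteq> ?X v" for u v
    using that by (auto simp: thick_component_eq_iff adjacent_thick_subgraph not_less_eq_eq)
  ultimately have "width G (contraction G ?X) ?X \<le> k"
    using fibre_thick_component[OF graph(1)] by (simp add: width_contraction_le_iff)
  moreover have "tree_cut_decomposition G (contraction G ?X) ?X"
    using tree_contraction by (simp add: tree_cut_decomposition_def)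
  ultimately show ?thesis using screewidth_le_width[OF graph(1)] order_trans by blast
qed

theorem theorem3p1:
  fixes G :: "('v, 'e) mgraph" and k :: nat
  assumes "banana_tree G"
    and "k = (GREATEST j. 0 < j \<and> has_banana_core G j)"
  shows "scramble_number G = enat k \<and> screewidth G = k"
proof -
  note graph = banana_treeD[OF assms(1)]
  note core = has_banana_core_Greatest[OF graph(1) assms(2)]
  have "enat k \<le> scramble_number G"
    using graph(1) core(1) by (rule has_banana_core_le_scramble_number)
  moreover have "scramble_number G \<le> enat (screewidth G)"
    using graph(1) by (rule scramble_number_le_screewidth)
  moreover have "screewidth G \<le> k"
    using graph core(2) by (rule screewidth_le_if_no_banana_core)
  ultimately show ?thesis
    by (metis enat_ord_simps(1) order.antisym order.trans)
qed

end
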